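(* Let $\mathbb G$ be a category, let $(\mathscr A,\mathtt{A})$ be a surcomplete surcategory over $\mathbb G$ with $K$-equalizers, and let $F:(\mathscr A,\mathtt{A})\to(\mathscr B,\mathtt{A})$ be a surfunctor over $\mathbb G$. Then the following are equivalent: (i) $F$ has a left suradjoint; (ii) $F$ preserves surlimits and $K$-equalizers, and every object $B$ of $\mathscr B$ has a solution set condition for $F$.
   Context: A surcategory over $\mathbb G$ is a pair $(\mathscr E,\mathtt{A})$ with $\mathtt{A}:\mathscr E\to\mathbb G$ a functor (the arity functor; the same letter is used for all surcategories), i.e. an object of the 2-category $\mathrm{Cat}/\mathbb G$. A surfunctor is a functor commuting with the arity functors. A suradjunction is an adjunction in $\mathrm{Cat}/\mathbb G$: both functors are surfunctors and the components of unit and counit are sent to identities by the arity functors. Surlimits: let $J$ be a small category, $D:J\to\mathscr E$ a functor and $B$ an object of $\mathbb G$ such that $\mathtt{A}D$ is the constant functor $\Delta(B)$. A surlimit of $(D,B)$ is an object $x$ with $\mathtt{A}(x)=B$ and a cone $\tau:\Delta(x)\to D$ whose components are sent by $\mathtt{A}$ to $1_B$, such that for every object $y$, every arrow $b:\mathtt{A}(y)\to B$ in $\mathbb G$ and every cone $\sigma:\Delta(y)\to D$ all of whose components are sent by $\mathtt{A}$ to $b$, there is a unique $f:y\to x$ in $\mathscr E$ with $\mathtt{A}(f)=b$ and $\tau\Delta(f)=\sigma$. $(\mathscr E,\mathtt{A})$ is surcomplete if for every small $J$ (including the empty one) every such $(D,B)$ has a surlimit. $(\mathscr E,\mathtt{A})$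 has $K$-equalizers if every pair $f,g:a\rightrightarrows b$ in $\mathscr E$ with $\mathtt{A}(f)=\mathtt{A}(g)$ has an equalizer $e$ in $\mathscr E$ with $\mathtt{A}(e)=1_{\mathtt{A}(a)}$. An object $B$ of $\mathscr B$ has a solution set condition for $F$ if there are a set $I$ and a family $(X_i,b_i)_{i\in I}$ with $X_i$ in $\mathscr A$, $b_i:B\to F(X_i)$ in $\mathscr B$ and $\mathtt{A}(b_i)=1_{\mathtt{A}(B)}$, such that for every $X$ in $\mathscr A$ and $b:B\to F(X)$ in $\mathscr B$ there are $i\in I$ and $a_i:X_i\to X$ in $\mathscr A$ with $F(a_i)b_i=b$. *)

theory Defs
  imports Main "HOL-Library.Equipollence"
begin

section \<open>Categories, functors, natural transformations\<close>

record ('o, 'a) cat =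
  Obj :: "'o set"
  Arr :: "'a set"
  Dom :: "'a \<Rightarrow> 'o"
  Cod :: "'a \<Rightarrow> 'o"
  Idn :: "'o \<Rightarrow> 'a"
  Comp :: "'a \<Rightarrow> 'a \<Rightarrow> 'a"  (infixl "\<cdot>\<index>" 70)

definition hom :: "('o, 'a) cat \<Rightarrow> 'o \<Rightarrow> 'o \<Rightarrow> 'a set" where
  "hom C x y = {f \<in> Arr C. Dom C f = x \<and> Cod C f = y}"

text \<open>\<open>g \<cdot> f\<close> is ``first \<open>f\<close>, then \<open>g\<close>''; it is only meaningful when the codomain of \<open>f\<close>
  is the domain of \<open>g\<close>.\<close>

locale category =
  fixes C :: "('o, 'a) cat" (structure)
  assumes Dom_Obj: "f \<in> Arr C \<Longrightarrow> Dom C f \<in> Obj C"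
    and Cod_Obj: "f \<in> Arr C \<Longrightarrow> Cod C f \<in> Obj C"
    and Idn_hom: "x \<in> Obj C \<Longrightarrow> Idn C x \<in> hom C x x"
    and Comp_hom: "f \<in> hom C x y \<Longrightarrow> g \<in> hom C y z \<Longrightarrow> g \<cdot> f \<in> hom C x z"
    and Comp_Idn_right: "f \<in> hom C x y \<Longrightarrow> f \<cdot> Idn C x = f"
    and Comp_Idn_left: "f \<in> hom C x y \<Longrightarrow> Idn C y \<cdot> f = f"
    and Comp_assoc:
      "f \<in> hom C w x \<Longrightarrow> g \<in> hom C x y \<Longrightarrow> h \<in> hom C y z \<Longrightarrow> (h \<cdot> g) \<cdot> f = h \<cdot> (g \<cdot> f)"

record ('o, 'a, 'p, 'b) fctr =
  fob :: "'o \<Rightarrow> 'p"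
  far :: "'a \<Rightarrow> 'b"

locale cat_functor = dom: category C + cod: category D
  for C :: "('o, 'a) cat" and D :: "('p, 'b) cat" +
  fixes F :: "('o, 'a, 'p, 'b) fctr"
  assumes fob_Obj: "x \<in> Obj C \<Longrightarrow> fob F x \<in> Obj D"
    and far_hom: "f \<in> hom C x y \<Longrightarrow> far F f \<in> hom D (fob F x) (fob F y)"
    and far_Idn: "x \<in> Obj C \<Longrightarrow> far F (Idn C x) = Idn D (fob F x)"
    and far_Comp:
      "f \<in> hom C x y \<Longrightarrow> g \<in> hom C y z \<Longrightarrow> far F (g \<cdot>\<^bsub>C\<^esub> f) = far F g \<cdot>\<^bsub>D\<^esub> far F f"

definition id_fctr :: "('o, 'a, 'o, 'a) fctr" where
  "id_fctr = \<lparr>fob = (\<lambda>x. x), far = (\<lambda>f. f)\<rparr>"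

definition comp_fctr ::
  "('p, 'b, 'q, 'c) fctr \<Rightarrow> ('o, 'a, 'p, 'b) fctr \<Rightarrow> ('o, 'a, 'q, 'c) fctr"
  (infixl "\<circ>\<^sub>F" 55) where
  "G \<circ>\<^sub>F F = \<lparr>fob = fob G \<circ> fob F, far = far G \<circ> far F\<rparr>"

definition const_fctr :: "('p, 'b) cat \<Rightarrow> 'p \<Rightarrow> ('o, 'a, 'p, 'b) fctr" where
  "const_fctr D x = \<lparr>fob = (\<lambda>_. x), far = (\<lambda>_. Idn D x)\<rparr>"

text \<open>Functors are represented by total functions, so two of them are identified when they agree
  on the carriers of their domain.\<close>

definition fctr_eq ::
  "('o, 'a) cat \<Rightarrow> ('o, 'a, 'p, 'b) fctr \<Rightarrow> ('o, 'a, 'p, 'b) fctr \<Rightarrow> bool" where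
  "fctr_eq C F G \<longleftrightarrow>
     (\<forall>x \<in> Obj C. fob F x = fob G x) \<and> (\<forall>f \<in> Arr C. far F f = far G f)"

definition nat_transf ::
  "('o, 'a) cat \<Rightarrow> ('p, 'b) cat \<Rightarrow> ('o, 'a, 'p, 'b) fctr \<Rightarrow> ('o, 'a, 'p, 'b) fctr
    \<Rightarrow> ('o \<Rightarrow> 'b) \<Rightarrow> bool" where
  "nat_transf C D F G \<tau> \<longleftrightarrow>
     (\<forall>x \<in> Obj C. \<tau> x \<in> hom D (fob F x) (fob G x)) \<and>
     (\<forall>f \<in> Arr C. \<tau> (Cod C f) \<cdot>\<^bsub>D\<^esub> far F f = far G f \<cdot>\<^bsub>D\<^esub> \<tau> (Dom C f))"

text \<open>A cone \<open>\<Delta>(x) \<rightarrow> D\<close>.\<close>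

definition cone ::
  "('j, 'k) cat \<Rightarrow> ('o, 'a) cat \<Rightarrow> ('j, 'k, 'o, 'a) fctr \<Rightarrow> 'o \<Rightarrow> ('j \<Rightarrow> 'a) \<Rightarrow> bool" where
  "cone J E D x \<tau> \<longleftrightarrow> nat_transf J E (const_fctr E x) D \<tau>"

definition is_equalizer :: "('o, 'a) cat \<Rightarrow> 'a \<Rightarrow> 'a \<Rightarrow> 'a \<Rightarrow> bool" where
  "is_equalizer E f g e \<longleftrightarrow>
     e \<in> Arr E \<and> Cod E e = Dom E f \<and> f \<cdot>\<^bsub>E\<^esub> e = g \<cdot>\<^bsub>E\<^esub> e \<and>
     (\<forall>y \<in> Obj E. \<forall>h \<in> hom E y (Dom E f). f \<cdot>\<^bsub>E\<^esub> h = g \<cdot>\<^bsub>E\<^esub> h \<longrightarrow>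
        (\<exists>!k. k \<in> hom E y (Dom E e) \<and> e \<cdot>\<^bsub>E\<^esub> k = h))"


section \<open>Size\<close>

text \<open>Smallness is relative to a set \<open>U\<close>: small means of cardinality strictly less than that of
  \<open>U\<close>. If \<open>U\<close> has inaccessible cardinality \<open>\<kappa>\<close>, these are, up to bijection, exactly the sets
  belonging to the Grothendieck universe \<open>V\<^sub>\<kappa>\<close>. Since \<open>U\<close> is a set of elements of \<open>'u\<close>, every
  small set has a copy inside \<open>'u\<close>, so small index categories and small index sets may be taken
  to be carried by \<open>'u\<close> without loss of generality.\<close>

definition small :: "'u set \<Rightarrow> 's set \<Rightarrow> bool" where
  "small U S \<longleftrightarrow> S \<prec> U"

definition small_category :: "'u set \<Rightarrow> ('o, 'a) cat \<Rightarrow> bool" where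
  "small_category U C \<longleftrightarrow> category C \<and> small U (Obj C) \<and> small U (Arr C)"

definition locally_small :: "'u set \<Rightarrow> ('o, 'a) cat \<Rightarrow> bool" where
  "locally_small U C \<longleftrightarrow> (\<forall>x \<in> Obj C. \<forall>y \<in> Obj C. small U (hom C x y))"


section \<open>Surcategories\<close>

locale surcategory = cat_functor E G A
  for G :: "('g, 'h) cat" and E :: "('o, 'a) cat" and A :: "('o, 'a, 'g, 'h) fctr"

locale surfunctor =
  dom_sur: surcategory G E A + cod_sur: surcategory G E' A' + cat_functor E E' F
  for G :: "('g, 'h) cat"
    and E :: "('o, 'a) cat" and A :: "('o, 'a, 'g, 'h) fctr"
    and E' :: "('p, 'b) cat" and A' :: "('p, 'b, 'g, 'h) fctr"
    and F :: "('o, 'a, 'p, 'b) fctr" +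
  assumes arity_commute: "fctr_eq E (A' \<circ>\<^sub>F F) A"

text \<open>\<open>L\<close> from \<open>(E', A')\<close> to \<open>(E, A)\<close> is left suradjoint to \<open>F\<close>, with unit \<open>\<eta>\<close> and
  counit \<open>\<epsilon>\<close>.\<close>

definition suradjunction ::
  "('g, 'h) cat \<Rightarrow> ('o, 'a) cat \<Rightarrow> ('o, 'a, 'g, 'h) fctr \<Rightarrow>
   ('p, 'b) cat \<Rightarrow> ('p, 'b, 'g, 'h) fctr \<Rightarrow>
   ('p, 'b, 'o, 'a) fctr \<Rightarrow> ('o, 'a, 'p, 'b) fctr \<Rightarrow> ('p \<Rightarrow> 'b) \<Rightarrow> ('o \<Rightarrow> 'a) \<Rightarrow> bool" where
  "suradjunction G E A E' A' L F \<eta> \<epsilon> \<longleftrightarrow>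
     surfunctor G E' A' E A L \<and>
     surfunctor G E A E' A' F \<and>
     nat_transf E' E' id_fctr (F \<circ>\<^sub>F L) \<eta> \<and>
     nat_transf E E (L \<circ>\<^sub>F F) id_fctr \<epsilon> \<and>
     (\<forall>y \<in> Obj E'. \<epsilon> (fob L y) \<cdot>\<^bsub>E\<^esub> far L (\<eta> y) = Idn E (fob L y)) \<and>
     (\<forall>x \<in> Obj E. far F (\<epsilon> x) \<cdot>\<^bsub>E'\<^esub> \<eta> (fob F x) = Idn E' (fob F x)) \<and>
     (\<forall>y \<in> Obj E'. far A' (\<eta> y) = Idn G (fob A' y)) \<and>
     (\<forall>x \<in> Obj E. far A (\<epsilon> x) = Idn G (fob A x))"

definition has_left_suradjoint ::
  "('g, 'h) cat \<Rightarrow> ('o, 'a) cat \<Rightarrow> ('o, 'a, 'g, 'h) fctr \<Rightarrow>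
   ('p, 'b) cat \<Rightarrow> ('p, 'b, 'g, 'h) fctr \<Rightarrow> ('o, 'a, 'p, 'b) fctr \<Rightarrow> bool" where
  "has_left_suradjoint G E A E' A' F \<longleftrightarrow> (\<exists>L \<eta> \<epsilon>. suradjunction G E A E' A' L F \<eta> \<epsilon>)"


section \<open>Surlimits and K-equalizers\<close>

text \<open>The pairs \<open>(D, b)\<close> that may have a surlimit. For empty \<open>J\<close> the object \<open>b\<close> is not
  determined by \<open>D\<close>.\<close>

definition surdiagram ::
  "('g, 'h) cat \<Rightarrow> ('o, 'a) cat \<Rightarrow> ('o, 'a, 'g, 'h) fctr \<Rightarrow>
   ('j, 'k) cat \<Rightarrow> ('j, 'k, 'o, 'a) fctr \<Rightarrow> 'g \<Rightarrow> bool" where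
  "surdiagram G E A J D b \<longleftrightarrow>
     cat_functor J E D \<and> b \<in> Obj G \<and> fctr_eq J (A \<circ>\<^sub>F D) (const_fctr G b)"

definition is_surlimit ::
  "('g, 'h) cat \<Rightarrow> ('o, 'a) cat \<Rightarrow> ('o, 'a, 'g, 'h) fctr \<Rightarrow>
   ('j, 'k) cat \<Rightarrow> ('j, 'k, 'o, 'a) fctr \<Rightarrow> 'g \<Rightarrow> 'o \<Rightarrow> ('j \<Rightarrow> 'a) \<Rightarrow> bool" where
  "is_surlimit G E A J D b x \<tau> \<longleftrightarrow>
     x \<in> Obj E \<and> fob A x = b \<and> cone J E D x \<tau> \<and> (\<forall>j \<in> Obj J. far A (\<tau> j) = Idn G b) \<and>
     (\<forall>y \<in> Obj E. \<forall>u \<in> hom G (fob A y) b. \<forall>\<sigma>.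
        cone J E D y \<sigma> \<and> (\<forall>j \<in> Obj J. far A (\<sigma> j) = u) \<longrightarrow>
        (\<exists>!f. f \<in> hom E y x \<and> far A f = u \<and> (\<forall>j \<in> Obj J. \<tau> j \<cdot>\<^bsub>E\<^esub> f = \<sigma> j)))"

definition surcomplete ::
  "'u set \<Rightarrow> ('g, 'h) cat \<Rightarrow> ('o, 'a) cat \<Rightarrow> ('o, 'a, 'g, 'h) fctr \<Rightarrow> bool" where
  "surcomplete U G E A \<longleftrightarrow>
     (\<forall>(J :: ('u, 'u) cat) D b. small_category U J \<and> surdiagram G E A J D b \<longrightarrow>
        (\<exists>x \<tau>. is_surlimit G E A J D b x \<tau>))"

definition preserves_surlimits ::
  "'u set \<Rightarrow> ('g, 'h) cat \<Rightarrow> ('o, 'a) cat \<Rightarrow> ('o, 'a, 'g, 'h) fctr \<Rightarrow>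
   ('p, 'b) cat \<Rightarrow> ('p, 'b, 'g, 'h) fctr \<Rightarrow> ('o, 'a, 'p, 'b) fctr \<Rightarrow> bool" where
  "preserves_surlimits U G E A E' A' F \<longleftrightarrow>
     (\<forall>(J :: ('u, 'u) cat) D b x \<tau>.
        small_category U J \<and> surdiagram G E A J D b \<and> is_surlimit G E A J D b x \<tau> \<longrightarrow>
        is_surlimit G E' A' J (F \<circ>\<^sub>F D) b (fob F x) (far F \<circ> \<tau>))"

definition K_pair ::
  "('o, 'a) cat \<Rightarrow> ('o, 'a, 'g, 'h) fctr \<Rightarrow> 'a \<Rightarrow> 'a \<Rightarrow> bool" where
  "K_pair E A f g \<longleftrightarrow>
     f \<in> Arr E \<and> g \<in> Arr E \<and> Dom E f = Dom E g \<and> Cod E f = Cod E g \<and> far A f = far A g"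

definition is_K_equalizer ::
  "('g, 'h) cat \<Rightarrow> ('o, 'a) cat \<Rightarrow> ('o, 'a, 'g, 'h) fctr \<Rightarrow> 'a \<Rightarrow> 'a \<Rightarrow> 'a \<Rightarrow> bool" where
  "is_K_equalizer G E A f g e \<longleftrightarrow>
     is_equalizer E f g e \<and> far A e = Idn G (fob A (Dom E f))"

definition has_K_equalizers ::
  "('g, 'h) cat \<Rightarrow> ('o, 'a) cat \<Rightarrow> ('o, 'a, 'g, 'h) fctr \<Rightarrow> bool" where
  "has_K_equalizers G E A \<longleftrightarrow>
     (\<forall>f g. K_pair E A f g \<longrightarrow> (\<exists>e. is_K_equalizer G E A f g e))"

definition preserves_K_equalizers ::
  "('g, 'h) cat \<Rightarrow> ('o, 'a) cat \<Rightarrow> ('o, 'a, 'g, 'h) fctr \<Rightarrow>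
   ('p, 'b) cat \<Rightarrow> ('p, 'b, 'g, 'h) fctr \<Rightarrow> ('o, 'a, 'p, 'b) fctr \<Rightarrow> bool" where
  "preserves_K_equalizers G E A E' A' F \<longleftrightarrow>
     (\<forall>f g e. K_pair E A f g \<and> is_K_equalizer G E A f g e \<longrightarrow>
        is_K_equalizer G E' A' (far F f) (far F g) (far F e))"


section \<open>Solution sets\<close>

definition solution_set_condition ::
  "'u set \<Rightarrow> ('g, 'h) cat \<Rightarrow> ('o, 'a) cat \<Rightarrow>
   ('p, 'b) cat \<Rightarrow> ('p, 'b, 'g, 'h) fctr \<Rightarrow> ('o, 'a, 'p, 'b) fctr \<Rightarrow> 'p \<Rightarrow> bool" where
  "solution_set_condition U G E E' A' F y \<longleftrightarrow>
     (\<exists>(I :: 'u set) X b.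
        small U I \<and>
        (\<forall>i \<in> I. X i \<in> Obj E \<and> b i \<in> hom E' y (fob F (X i)) \<and>
           far A' (b i) = Idn G (fob A' y)) \<and>
        (\<forall>x \<in> Obj E. \<forall>c \<in> hom E' y (fob F x).
           \<exists>i \<in> I. \<exists>a \<in> hom E (X i) x. far F a \<cdot>\<^bsub>E'\<^esub> b i = c))"

end

theory Submission
  imports Defs
begin

text \<open>
  This is Freyd's adjoint functor theorem with arities. The link between the two sides is the
  notion of a universal arrow \<open>n\<close> from an object \<open>y\<close> to \<open>F\<close> whose arity is an identity
  (\<open>sur_universal\<close>): a left suradjoint amounts to a choice of such an arrow for every \<open>y\<close>
  (\<open>suradjunction_universal\<close>, \<open>universal_arrows_suradjoint\<close>). What makes the classical arguments go
  through is that transposing along an arrow of identity arity does not change the arity of an arrow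
  (\<open>arity_transpose\<close>).

  If all universal arrows exist, then transposing cones and forks to the domain category shows that
  \<open>F\<close> preserves surlimits and \<open>K\<close>-equalizers, and the universal arrow by itself is a solution
  set.

  For the converse, fix \<open>y\<close>. The surproduct of the members of a solution set carries a weakly
  universal arrow \<open>b : y \<rightarrow> F p\<close> (\<open>solution_set_weakly_universal\<close>). Endomorphisms of
  \<open>p\<close> that fix \<open>b\<close> have identity arity and form a small set, so a surpower of \<open>p\<close> and one
  \<open>K\<close>-equalizer yield their joint equalizer \<open>m : q \<rightarrow> p\<close>, through which \<open>b\<close> factors
  (\<open>endomorphism_equalizer\<close>). The factor \<open>n : y \<rightarrow> F q\<close> is universal: two arrows out of
  \<open>q\<close> whose images under \<open>F\<close> agree after \<open>n\<close> have the same arity, hence a \<open>K\<close>-equalizer, and weak universality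
  together with the definition of \<open>m\<close> splits that equalizer
  (\<open>solution_set_sur_universal\<close>). The surlimits used are surproducts, indexed by a solution set
  and by a subset of a hom set, so their index categories are discrete and small.
\<close>

section \<open>Categories and arities\<close>

context category
begin

lemma hom_Obj:
  assumes "f \<in> hom C x y"
  shows "x \<in> Obj C" "y \<in> Obj C"
  using assms Dom_Obj Cod_Obj by (auto simp: hom_def)

lemma equalizer_factor:
  assumes "is_equalizer C f g e" and "f \<in> hom C x y" and "h \<in> hom C z x" and "f \<cdot> h = g \<cdot> h"
  shows "\<exists>k \<in> hom C z (Dom C e). e \<cdot> k = h"
proof -
  have z: "z \<in> Obj C" and x: "Dom C f = x"
    using assms hom_Obj(1) by (auto simp: hom_def)
  then have "\<exists>!k. k \<in> hom C z (Dom C e) \<and> e \<cdot> k = h"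
    using assms unfolding is_equalizer_def by blast
  then show ?thesis by blast
qed

lemma equalizer_monic:
  assumes eq: "is_equalizer C f g e" and f: "f \<in> hom C x y" and g: "g \<in> hom C x y"
    and k: "k \<in> hom C z (Dom C e)" and l: "l \<in> hom C z (Dom C e)" and kl: "e \<cdot> k = e \<cdot> l"
  shows "k = l"
proof -
  have e: "e \<in> hom C (Dom C e) x" and x: "Dom C f = x" and fe: "f \<cdot> e = g \<cdot> e"
    using eq f by (auto simp: is_equalizer_def hom_def)
  have "f \<cdot> (e \<cdot> k) = g \<cdot> (e \<cdot> k)"
    using Comp_assoc[OF k e f] Comp_assoc[OF k e g] fe by simp
  moreover have "e \<cdot> k \<in> hom C z x" by (rule Comp_hom[OF k e])
  ultimately have "\<exists>!m. m \<in> hom C z (Dom C e) \<and> e \<cdot> m = e \<cdot> k"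
    using eq hom_Obj(1)[OF k] x unfolding is_equalizer_def by auto
  then show ?thesis using k l kl by metis
qed

end

context surcategory
begin

lemma identity_arity_fob:
  assumes "f \<in> hom E x y" and "far A f = Idn G b" and "b \<in> Obj G"
  shows "fob A x = b" "fob A y = b"
  using far_hom[OF assms(1)] cod.Idn_hom[OF assms(3)] assms(2) by (auto simp: hom_def)

lemma far_Comp_identity_right:
  assumes "f \<in> hom E x y" and "g \<in> hom E y z" and "far A f = Idn G b" and "b \<in> Obj G"
  shows "far A (g \<cdot>\<^bsub>E\<^esub> f) = far A g"
  using far_Comp[OF assms(1,2)] far_hom[OF assms(2)] cod.Comp_Idn_right
    identity_arity_fob[OF assms(1,3,4)] assms(3) by metis

lemma far_Comp_identity_left:
  assumes "f \<in> hom E x y" and "g \<in> hom E y z" and "far A g = Idn G b" and "b \<in> Obj G"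
  shows "far A (g \<cdot>\<^bsub>E\<^esub> f) = far A f"
  using far_Comp[OF assms(1,2)] far_hom[OF assms(1)] cod.Comp_Idn_left
    identity_arity_fob[OF assms(2,3,4)] assms(3) by metis

lemma K_equalizer_hom:
  assumes "is_K_equalizer G E A f g e" and "f \<in> hom E x y"
  shows "e \<in> hom E (Dom E e) x" "far A e = Idn G (fob A x)"
  using assms by (auto simp: is_K_equalizer_def is_equalizer_def hom_def)

end

section \<open>Universal arrows of identity arity\<close>

text \<open>A universal arrow from \<open>y\<close> to \<open>F\<close>, that is, a component of the unit. While \<open>n\<close> has identity
  arity, the arrows \<open>c\<close> that factor through it range over all arities, because an adjunction
  over \<open>G\<close> transposes arrows of every arity.\<close>

definition sur_universal ::
  "('g, 'h) cat \<Rightarrow> ('o, 'a) cat \<Rightarrow> ('p, 'b) cat \<Rightarrow> ('p, 'b, 'g, 'h) fctr \<Rightarrow>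
   ('o, 'a, 'p, 'b) fctr \<Rightarrow> 'p \<Rightarrow> 'o \<Rightarrow> 'b \<Rightarrow> bool" where
  "sur_universal G E E' A' F y x n \<longleftrightarrow>
     x \<in> Obj E \<and> n \<in> hom E' y (fob F x) \<and> far A' n = Idn G (fob A' y) \<and>
     (\<forall>x' \<in> Obj E. \<forall>c \<in> hom E' y (fob F x'). \<exists>!a. a \<in> hom E x x' \<and> far F a \<cdot>\<^bsub>E'\<^esub> n = c)"

context surfunctor
begin

lemma arity_fob: "x \<in> Obj E \<Longrightarrow> fob A' (fob F x) = fob A x"
  using arity_commute by (simp add: fctr_eq_def comp_fctr_def)

lemma arity_far: "f \<in> hom E x y \<Longrightarrow> far A' (far F f) = far A f"
  using arity_commute by (simp add: fctr_eq_def comp_fctr_def hom_def)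

text \<open>Transposition along an arrow of identity arity does not change arities. This is why arities need
  no separate bookkeeping in the factorizations below.\<close>

lemma arity_transpose:
  assumes "n \<in> hom E' y (fob F x)" and "far A' n = Idn G (fob A' y)" and "a \<in> hom E x x'"
  shows "far A a = far A' (far F a \<cdot>\<^bsub>E'\<^esub> n)"
  using cod_sur.far_Comp_identity_right[OF assms(1) far_hom[OF assms(3)] assms(2)]
    cod_sur.fob_Obj cod_sur.dom.hom_Obj[OF assms(1)] arity_far[OF assms(3)] by simp

lemma far_Comp_action:
  assumes "n \<in> hom E' y (fob F x)" and "a \<in> hom E x x'" and "b \<in> hom E x' x''"
  shows "far F (b \<cdot>\<^bsub>E\<^esub> a) \<cdot>\<^bsub>E'\<^esub> n = far F b \<cdot>\<^bsub>E'\<^esub> (far F a \<cdot>\<^bsub>E'\<^esub> n)"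
  using far_Comp[OF assms(2,3)]
    cod_sur.dom.Comp_assoc[OF assms(1) far_hom[OF assms(2)] far_hom[OF assms(3)]] by simp

lemma sur_universal_factor:
  assumes "sur_universal G E E' A' F y x n" and "c \<in> hom E' y (fob F x')" and "x' \<in> Obj E"
  obtains a where "a \<in> hom E x x'" "far F a \<cdot>\<^bsub>E'\<^esub> n = c"
  using assms unfolding sur_universal_def by blast

text \<open>The working form of uniqueness: arrows out of the universal object are compared after transposing
  them.\<close>

lemma sur_universal_eqI:
  assumes "sur_universal G E E' A' F y x n" and "a \<in> hom E x x'" and "a' \<in> hom E x x'"
    and "far F a \<cdot>\<^bsub>E'\<^esub> n = far F a' \<cdot>\<^bsub>E'\<^esub> n"
  shows "a = a'"
proof -
  have "far F a \<cdot>\<^bsub>E'\<^esub> n \<in> hom E' y (fob F x')"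
    using assms(1,2) cod_sur.dom.Comp_hom far_hom unfolding sur_universal_def by blast
  moreover have "x' \<in> Obj E" using assms(2) dom_sur.dom.hom_Obj by blast
  ultimately show ?thesis
    using assms unfolding sur_universal_def by metis
qed

text \<open>The factorization of \<open>c\<close> is \<open>\<epsilon> x\<close> after \<open>far L c\<close>. That it works is one triangle identity, that
  it is the only one is the other.\<close>

lemma suradjunction_universal:
  assumes adj: "suradjunction G E A E' A' L F \<eta> \<epsilon>" and y: "y \<in> Obj E'"
  shows "sur_universal G E E' A' F y (fob L y) (\<eta> y)"
proof -
  interpret L: surfunctor G E' A' E A L using adj by (simp add: suradjunction_def)
  have \<eta>: "\<eta> z \<in> hom E' z (fob F (fob L z))" if "z \<in> Obj E'" for z
    using adj that by (simp add: suradjunction_def nat_transf_def id_fctr_def comp_fctr_def)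
  have \<eta>nat: "\<eta> w \<cdot>\<^bsub>E'\<^esub> f = far F (far L f) \<cdot>\<^bsub>E'\<^esub> \<eta> z" if "f \<in> hom E' z w" for f z w
    using adj that
    by (auto simp: suradjunction_def nat_transf_def id_fctr_def comp_fctr_def hom_def)
  have \<epsilon>: "\<epsilon> z \<in> hom E (fob L (fob F z)) z" if "z \<in> Obj E" for z
    using adj that by (simp add: suradjunction_def nat_transf_def id_fctr_def comp_fctr_def)
  have \<epsilon>nat: "\<epsilon> w \<cdot>\<^bsub>E\<^esub> far L (far F f) = f \<cdot>\<^bsub>E\<^esub> \<epsilon> z" if "f \<in> hom E z w" for f z w
    using adj that
    by (auto simp: suradjunction_def nat_transf_def id_fctr_def comp_fctr_def hom_def)
  have "\<exists>!a. a \<in> hom E (fob L y) x \<and> far F a \<cdot>\<^bsub>E'\<^esub> \<eta> y = c"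
    if x: "x \<in> Obj E" and c: "c \<in> hom E' y (fob F x)" for x c
  proof (rule ex1I[of _ "\<epsilon> x \<cdot>\<^bsub>E\<^esub> far L c"], intro conjI)
    note Lc = L.far_hom[OF c]
    show "\<epsilon> x \<cdot>\<^bsub>E\<^esub> far L c \<in> hom E (fob L y) x"
      by (rule dom_sur.dom.Comp_hom[OF Lc \<epsilon>[OF x]])
    have "far F (\<epsilon> x \<cdot>\<^bsub>E\<^esub> far L c) \<cdot>\<^bsub>E'\<^esub> \<eta> y = far F (\<epsilon> x) \<cdot>\<^bsub>E'\<^esub> (\<eta> (fob F x) \<cdot>\<^bsub>E'\<^esub> c)"
      using far_Comp_action[OF \<eta>[OF y] Lc \<epsilon>[OF x]] \<eta>nat[OF c] by simp
    also have "\<dots> = (far F (\<epsilon> x) \<cdot>\<^bsub>E'\<^esub> \<eta> (fob F x)) \<cdot>\<^bsub>E'\<^esub> c"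
      using cod_sur.dom.Comp_assoc[OF c \<eta>[OF fob_Obj[OF x]] far_hom[OF \<epsilon>[OF x]]] by simp
    also have "\<dots> = c"
      using adj x cod_sur.dom.Comp_Idn_left[OF c] by (simp add: suradjunction_def)
    finally show "far F (\<epsilon> x \<cdot>\<^bsub>E\<^esub> far L c) \<cdot>\<^bsub>E'\<^esub> \<eta> y = c" .
  next
    fix a assume "a \<in> hom E (fob L y) x \<and> far F a \<cdot>\<^bsub>E'\<^esub> \<eta> y = c"
    then have a: "a \<in> hom E (fob L y) x" and c': "c = far F a \<cdot>\<^bsub>E'\<^esub> \<eta> y" by auto
    note L\<eta> = L.far_hom[OF \<eta>[OF y]]
    have "\<epsilon> x \<cdot>\<^bsub>E\<^esub> far L c = \<epsilon> x \<cdot>\<^bsub>E\<^esub> (far L (far F a) \<cdot>\<^bsub>E\<^esub> far L (\<eta> y))"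
      using L.far_Comp[OF \<eta>[OF y] far_hom[OF a]] c' by simp
    also have "\<dots> = (\<epsilon> x \<cdot>\<^bsub>E\<^esub> far L (far F a)) \<cdot>\<^bsub>E\<^esub> far L (\<eta> y)"
      using dom_sur.dom.Comp_assoc[OF L\<eta> L.far_hom[OF far_hom[OF a]] \<epsilon>[OF x]] by simp
    also have "\<dots> = (a \<cdot>\<^bsub>E\<^esub> \<epsilon> (fob L y)) \<cdot>\<^bsub>E\<^esub> far L (\<eta> y)"
      using \<epsilon>nat[OF a] by simp
    also have "\<dots> = a \<cdot>\<^bsub>E\<^esub> (\<epsilon> (fob L y) \<cdot>\<^bsub>E\<^esub> far L (\<eta> y))"
      using dom_sur.dom.Comp_assoc[OF L\<eta> \<epsilon>[OF L.fob_Obj[OF y]] a] by simp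
    also have "\<dots> = a"
      using adj y dom_sur.dom.Comp_Idn_right[OF a] by (simp add: suradjunction_def)
    finally show "a = \<epsilon> x \<cdot>\<^bsub>E\<^esub> far L c" by simp
  qed
  then show ?thesis
    using adj y \<eta> L.fob_Obj by (simp add: sur_universal_def suradjunction_def)
qed

text \<open>A choice of universal arrows makes the object map \<open>l\<close> a functor \<open>L\<close>, with \<open>far L f\<close> the
  transpose of \<open>\<eta> y' \<cdot>\<^bsub>E'\<^esub> f\<close>, and the counit consists of the transposes of identities.
  Functoriality, naturality of \<open>\<epsilon>\<close> and the triangle identity at \<open>L\<close> are equations between arrows
  out of objects \<open>l y\<close>, so \<open>sur_universal_eqI\<close> proves each. Since \<open>\<eta>\<close> has identity arity,
  \<open>arity_transpose\<close> makes \<open>L\<close> a surfunctor and gives \<open>\<epsilon>\<close> identity arity.\<close>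

lemma universal_arrows_suradjoint:
  assumes ex: "\<And>y. y \<in> Obj E' \<Longrightarrow> \<exists>x n. sur_universal G E E' A' F y x n"
  shows "has_left_suradjoint G E A E' A' F"
proof -
  obtain l \<eta> where univ: "\<And>y. y \<in> Obj E' \<Longrightarrow> sur_universal G E E' A' F y (l y) (\<eta> y)"
    using ex by metis
  have l: "l y \<in> Obj E" and \<eta>: "\<eta> y \<in> hom E' y (fob F (l y))"
    and \<eta>1: "far A' (\<eta> y) = Idn G (fob A' y)" if "y \<in> Obj E'" for y
    using univ[OF that] by (auto simp: sur_universal_def)
  define lift where "lift y c x = (THE a. a \<in> hom E (l y) x \<and> far F a \<cdot>\<^bsub>E'\<^esub> \<eta> y = c)" for y c x
  have lift: "lift y c x \<in> hom E (l y) x" "far F (lift y c x) \<cdot>\<^bsub>E'\<^esub> \<eta> y = c"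
    if "x \<in> Obj E" "c \<in> hom E' y (fob F x)" for y c x
  proof -
    have "\<exists>!a. a \<in> hom E (l y) x \<and> far F a \<cdot>\<^bsub>E'\<^esub> \<eta> y = c"
      using univ cod_sur.dom.hom_Obj[OF that(2)] that unfolding sur_universal_def by blast
    from theI'[OF this] show "lift y c x \<in> hom E (l y) x" "far F (lift y c x) \<cdot>\<^bsub>E'\<^esub> \<eta> y = c"
      by (auto simp: lift_def)
  qed
  define L where
    "L = \<lparr>fob = l, far = (\<lambda>f. lift (Dom E' f) (\<eta> (Cod E' f) \<cdot>\<^bsub>E'\<^esub> f) (l (Cod E' f)))\<rparr>"
  define \<epsilon> where "\<epsilon> x = lift (fob F x) (Idn E' (fob F x)) x" for x
  have fobL[simp]: "fob L = l" by (simp add: L_def)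
  have \<epsilon>: "\<epsilon> x \<in> hom E (l (fob F x)) x" "far F (\<epsilon> x) \<cdot>\<^bsub>E'\<^esub> \<eta> (fob F x) = Idn E' (fob F x)"
    if "x \<in> Obj E" for x
    using lift[OF that cod_sur.dom.Idn_hom[OF fob_Obj[OF that]]] by (auto simp: \<epsilon>_def)
  have L: "far L f \<in> hom E (l y) (l y')" "far F (far L f) \<cdot>\<^bsub>E'\<^esub> \<eta> y = \<eta> y' \<cdot>\<^bsub>E'\<^esub> f"
    if f: "f \<in> hom E' y y'" for f y y'
  proof -
    note obj = cod_sur.dom.hom_Obj[OF f]
    have "Dom E' f = y" "Cod E' f = y'" using f by (auto simp: hom_def)
    then show "far L f \<in> hom E (l y) (l y')" "far F (far L f) \<cdot>\<^bsub>E'\<^esub> \<eta> y = \<eta> y' \<cdot>\<^bsub>E'\<^esub> f"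
      using lift[OF l[OF obj(2)] cod_sur.dom.Comp_hom[OF f \<eta>[OF obj(2)]]]
      by (auto simp: L_def)
  qed
  have Lfun: "cat_functor E' E L"
  proof
    show "fob L y \<in> Obj E" if "y \<in> Obj E'" for y using l[OF that] by simp
    show "far L f \<in> hom E (fob L y) (fob L y')" if "f \<in> hom E' y y'" for f y y'
      using L(1)[OF that] by simp
    show "far L (Idn E' y) = Idn E (fob L y)" if y: "y \<in> Obj E'" for y
    proof (rule sur_universal_eqI[OF univ[OF y]])
      note i = cod_sur.dom.Idn_hom[OF y]
      show "far L (Idn E' y) \<in> hom E (l y) (l y)" by (rule L(1)[OF i])
      show "Idn E (fob L y) \<in> hom E (l y) (l y)"
        using dom_sur.dom.Idn_hom[OF l[OF y]] by simp
      show "far F (far L (Idn E' y)) \<cdot>\<^bsub>E'\<^esub> \<eta> y = far F (Idn E (fob L y)) \<cdot>\<^bsub>E'\<^esub> \<eta> y"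
        using L(2)[OF i] far_Idn[OF l[OF y]] cod_sur.dom.Comp_Idn_left[OF \<eta>[OF y]]
          cod_sur.dom.Comp_Idn_right[OF \<eta>[OF y]] by simp
    qed
    show "far L (g \<cdot>\<^bsub>E'\<^esub> f) = far L g \<cdot>\<^bsub>E\<^esub> far L f"
      if f: "f \<in> hom E' x y" and g: "g \<in> hom E' y z" for f g x y z
    proof -
      note obj = cod_sur.dom.hom_Obj[OF f] cod_sur.dom.hom_Obj[OF g]
      note gf = cod_sur.dom.Comp_hom[OF f g]
      show ?thesis
      proof (rule sur_universal_eqI[OF univ[OF obj(1)]])
        show "far L (g \<cdot>\<^bsub>E'\<^esub> f) \<in> hom E (l x) (l z)" by (rule L(1)[OF gf])
        show "far L g \<cdot>\<^bsub>E\<^esub> far L f \<in> hom E (l x) (l z)"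
          by (rule dom_sur.dom.Comp_hom[OF L(1)[OF f] L(1)[OF g]])
        have "far F (far L g \<cdot>\<^bsub>E\<^esub> far L f) \<cdot>\<^bsub>E'\<^esub> \<eta> x = far F (far L g) \<cdot>\<^bsub>E'\<^esub> (\<eta> y \<cdot>\<^bsub>E'\<^esub> f)"
          using far_Comp_action[OF \<eta>[OF obj(1)] L(1)[OF f] L(1)[OF g]] L(2)[OF f] by simp
        also have "\<dots> = (\<eta> z \<cdot>\<^bsub>E'\<^esub> g) \<cdot>\<^bsub>E'\<^esub> f"
          using cod_sur.dom.Comp_assoc[OF f \<eta>[OF obj(2)] far_hom[OF L(1)[OF g]]] L(2)[OF g]
          by simp
        also have "\<dots> = far F (far L (g \<cdot>\<^bsub>E'\<^esub> f)) \<cdot>\<^bsub>E'\<^esub> \<eta> x"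
          using cod_sur.dom.Comp_assoc[OF f g \<eta>[OF obj(4)]] L(2)[OF gf] by simp
        finally show "far F (far L (g \<cdot>\<^bsub>E'\<^esub> f)) \<cdot>\<^bsub>E'\<^esub> \<eta> x =
            far F (far L g \<cdot>\<^bsub>E\<^esub> far L f) \<cdot>\<^bsub>E'\<^esub> \<eta> x" by simp
      qed
    qed
  qed
  have Lsur: "surfunctor G E' A' E A L"
  proof -
    have "fob A (l y) = fob A' y" if y: "y \<in> Obj E'" for y
      using cod_sur.identity_arity_fob(2)[OF \<eta>[OF y] \<eta>1[OF y] cod_sur.fob_Obj[OF y]]
        arity_fob[OF l[OF y]] by simp
    moreover have "far A (far L f) = far A' f" if "f \<in> Arr E'" for f
    proof -
      from that have f: "f \<in> hom E' (Dom E' f) (Cod E' f)" by (simp add: hom_def)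
      note obj = cod_sur.dom.hom_Obj[OF f]
      have "far A (far L f) = far A' (\<eta> (Cod E' f) \<cdot>\<^bsub>E'\<^esub> f)"
        using arity_transpose[OF \<eta>[OF obj(1)] \<eta>1[OF obj(1)] L(1)[OF f]] L(2)[OF f] by simp
      also have "\<dots> = far A' f"
        by (rule cod_sur.far_Comp_identity_left[OF f \<eta>[OF obj(2)] \<eta>1[OF obj(2)]
              cod_sur.fob_Obj[OF obj(2)]])
      finally show ?thesis .
    qed
    ultimately have "fctr_eq E' (A \<circ>\<^sub>F L) A'"
      by (simp add: fctr_eq_def comp_fctr_def)
    then show ?thesis
      using Lfun dom_sur.surcategory_axioms cod_sur.surcategory_axioms
      by (simp add: surfunctor_def surfunctor_axioms_def)
  qed
  have \<eta>nat: "nat_transf E' E' id_fctr (F \<circ>\<^sub>F L) \<eta>"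
    using \<eta> L(2) by (auto simp: nat_transf_def id_fctr_def comp_fctr_def hom_def)
  have \<epsilon>nat: "nat_transf E E (L \<circ>\<^sub>F F) id_fctr \<epsilon>"
  proof -
    have "\<epsilon> x' \<cdot>\<^bsub>E\<^esub> far L (far F f) = f \<cdot>\<^bsub>E\<^esub> \<epsilon> x" if f: "f \<in> hom E x x'" for f x x'
    proof -
      note obj = dom_sur.dom.hom_Obj[OF f]
      note FO = fob_Obj[OF obj(1)] fob_Obj[OF obj(2)]
      note Ff = far_hom[OF f]
      show ?thesis
      proof (rule sur_universal_eqI[OF univ[OF FO(1)]])
        show "\<epsilon> x' \<cdot>\<^bsub>E\<^esub> far L (far F f) \<in> hom E (l (fob F x)) x'"
          by (rule dom_sur.dom.Comp_hom[OF L(1)[OF Ff] \<epsilon>(1)[OF obj(2)]])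
        show "f \<cdot>\<^bsub>E\<^esub> \<epsilon> x \<in> hom E (l (fob F x)) x'"
          by (rule dom_sur.dom.Comp_hom[OF \<epsilon>(1)[OF obj(1)] f])
        have "far F (\<epsilon> x' \<cdot>\<^bsub>E\<^esub> far L (far F f)) \<cdot>\<^bsub>E'\<^esub> \<eta> (fob F x)
            = far F (\<epsilon> x') \<cdot>\<^bsub>E'\<^esub> (\<eta> (fob F x') \<cdot>\<^bsub>E'\<^esub> far F f)"
          using far_Comp_action[OF \<eta>[OF FO(1)] L(1)[OF Ff] \<epsilon>(1)[OF obj(2)]] L(2)[OF Ff] by simp
        also have "\<dots> = far F f"
          using cod_sur.dom.Comp_assoc[OF Ff \<eta>[OF FO(2)] far_hom[OF \<epsilon>(1)[OF obj(2)]]]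
            \<epsilon>(2)[OF obj(2)] cod_sur.dom.Comp_Idn_left[OF Ff] by simp
        also have "\<dots> = far F (f \<cdot>\<^bsub>E\<^esub> \<epsilon> x) \<cdot>\<^bsub>E'\<^esub> \<eta> (fob F x)"
          using far_Comp_action[OF \<eta>[OF FO(1)] \<epsilon>(1)[OF obj(1)] f] \<epsilon>(2)[OF obj(1)]
            cod_sur.dom.Comp_Idn_right[OF Ff] by simp
        finally show "far F (\<epsilon> x' \<cdot>\<^bsub>E\<^esub> far L (far F f)) \<cdot>\<^bsub>E'\<^esub> \<eta> (fob F x)
            = far F (f \<cdot>\<^bsub>E\<^esub> \<epsilon> x) \<cdot>\<^bsub>E'\<^esub> \<eta> (fob F x)" .
      qed
    qed
    then show ?thesis
      using \<epsilon>(1) by (auto simp: nat_transf_def id_fctr_def comp_fctr_def hom_def)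
  qed
  have triangle: "\<epsilon> (l y) \<cdot>\<^bsub>E\<^esub> far L (\<eta> y) = Idn E (l y)" if y: "y \<in> Obj E'" for y
  proof (rule sur_universal_eqI[OF univ[OF y]])
    note ly = l[OF y] and \<eta>y = \<eta>[OF y]
    show "\<epsilon> (l y) \<cdot>\<^bsub>E\<^esub> far L (\<eta> y) \<in> hom E (l y) (l y)"
      by (rule dom_sur.dom.Comp_hom[OF L(1)[OF \<eta>y] \<epsilon>(1)[OF ly]])
    show "Idn E (l y) \<in> hom E (l y) (l y)" by (rule dom_sur.dom.Idn_hom[OF ly])
    have "far F (\<epsilon> (l y) \<cdot>\<^bsub>E\<^esub> far L (\<eta> y)) \<cdot>\<^bsub>E'\<^esub> \<eta> y
        = far F (\<epsilon> (l y)) \<cdot>\<^bsub>E'\<^esub> (\<eta> (fob F (l y)) \<cdot>\<^bsub>E'\<^esub> \<eta> y)"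
      using far_Comp_action[OF \<eta>y L(1)[OF \<eta>y] \<epsilon>(1)[OF ly]] L(2)[OF \<eta>y] by simp
    also have "\<dots> = \<eta> y"
      using cod_sur.dom.Comp_assoc[OF \<eta>y \<eta>[OF fob_Obj[OF ly]] far_hom[OF \<epsilon>(1)[OF ly]]]
        \<epsilon>(2)[OF ly] cod_sur.dom.Comp_Idn_left[OF \<eta>y] by simp
    also have "\<dots> = far F (Idn E (l y)) \<cdot>\<^bsub>E'\<^esub> \<eta> y"
      using far_Idn[OF ly] cod_sur.dom.Comp_Idn_left[OF \<eta>y] by simp
    finally show "far F (\<epsilon> (l y) \<cdot>\<^bsub>E\<^esub> far L (\<eta> y)) \<cdot>\<^bsub>E'\<^esub> \<eta> y = far F (Idn E (l y)) \<cdot>\<^bsub>E'\<^esub> \<eta> y" .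
  qed
  have \<epsilon>1: "far A (\<epsilon> x) = Idn G (fob A x)" if x: "x \<in> Obj E" for x
    using arity_transpose[OF \<eta>[OF fob_Obj[OF x]] \<eta>1[OF fob_Obj[OF x]] \<epsilon>(1)[OF x]] \<epsilon>(2)[OF x]
      cod_sur.far_Idn[OF fob_Obj[OF x]] arity_fob[OF x] by simp
  have "suradjunction G E A E' A' L F \<eta> \<epsilon>"
    using Lsur surfunctor_axioms \<eta>nat \<epsilon>nat triangle \<epsilon>(2) \<eta>1 \<epsilon>1
    by (simp add: suradjunction_def)
  then show ?thesis unfolding has_left_suradjoint_def by blast
qed

end
section \<open>Right suradjoints preserve limits\<close>

context surfunctor
begin

text \<open>The usual proof that right adjoints preserve limits, with arities added. A cone over \<open>F \<circ>\<^sub>F D\<close>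
  with common arity \<open>u\<close> transposes along the universal arrow to a cone over \<open>D\<close>. By
  \<open>arity_transpose\<close> its components again have arity \<open>u\<close>, so the surlimit property, which
  constrains only cones of constant arity, applies to it.\<close>

lemma universal_arrows_preserve_surlimits:
  assumes univ: "\<And>y. y \<in> Obj E' \<Longrightarrow> \<exists>z n. sur_universal G E E' A' F y z n"
    and D: "surdiagram G E A J D b" and lim: "is_surlimit G E A J D b x \<tau>"
  shows "is_surlimit G E' A' J (F \<circ>\<^sub>F D) b (fob F x) (far F \<circ> \<tau>)"
proof -
  interpret D: cat_functor J E D using D by (simp add: surdiagram_def)
  have x: "x \<in> Obj E" and xb: "fob A x = b" and b: "b \<in> Obj G"
    using lim D by (auto simp: is_surlimit_def surdiagram_def)
  have \<tau>: "\<tau> j \<in> hom E x (fob D j)" and \<tau>1: "far A (\<tau> j) = Idn G b" if "j \<in> Obj J" for j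
    using lim that by (auto simp: is_surlimit_def cone_def nat_transf_def const_fctr_def)
  have \<tau>nat: "\<tau> (Cod J f) \<cdot>\<^bsub>E\<^esub> Idn E x = far D f \<cdot>\<^bsub>E\<^esub> \<tau> (Dom J f)" if "f \<in> Arr J" for f
    using lim that by (auto simp: is_surlimit_def cone_def nat_transf_def const_fctr_def)
  have Df: "far D f \<in> hom E (fob D (Dom J f)) (fob D (Cod J f))" if "f \<in> Arr J" for f
    using D.far_hom[of f] that by (auto simp: hom_def)
  have FD: "fob (F \<circ>\<^sub>F D) j = fob F (fob D j)" "far (F \<circ>\<^sub>F D) f = far F (far D f)" for j f
    by (auto simp: comp_fctr_def)
  have "cone J E' (F \<circ>\<^sub>F D) (fob F x) (far F \<circ> \<tau>)"
  proof -
    have "far F (\<tau> (Cod J f)) \<cdot>\<^bsub>E'\<^esub> Idn E' (fob F x) = far F (far D f) \<cdot>\<^bsub>E'\<^esub> far F (\<tau> (Dom J f))"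
      if f: "f \<in> Arr J" for f
      using arg_cong[OF \<tau>nat[OF f], of "far F"] far_Idn[OF x]
        far_Comp[OF dom_sur.dom.Idn_hom[OF x] \<tau>[OF D.dom.Cod_Obj[OF f]]]
        far_Comp[OF \<tau>[OF D.dom.Dom_Obj[OF f]] Df[OF f]] by simp
    then show ?thesis
      using far_hom[OF \<tau>] by (simp add: cone_def nat_transf_def const_fctr_def FD)
  qed
  moreover have "far A' ((far F \<circ> \<tau>) j) = Idn G b" if "j \<in> Obj J" for j
    using arity_far[OF \<tau>[OF that]] \<tau>1[OF that] by simp
  moreover have "\<exists>!f. f \<in> hom E' y (fob F x) \<and> far A' f = u \<and>
      (\<forall>j \<in> Obj J. (far F \<circ> \<tau>) j \<cdot>\<^bsub>E'\<^esub> f = \<sigma> j)"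
    if y: "y \<in> Obj E'" and u: "u \<in> hom G (fob A' y) b" and c: "cone J E' (F \<circ>\<^sub>F D) y \<sigma>"
      and \<sigma>u: "\<forall>j \<in> Obj J. far A' (\<sigma> j) = u" for y u \<sigma>
  proof -
    obtain z n where un: "sur_universal G E E' A' F y z n" using univ[OF y] by blast
    then have z: "z \<in> Obj E" and n: "n \<in> hom E' y (fob F z)"
      and n1: "far A' n = Idn G (fob A' y)" by (auto simp: sur_universal_def)
    have zy: "fob A z = fob A' y"
      using cod_sur.identity_arity_fob(2)[OF n n1 cod_sur.fob_Obj[OF y]] arity_fob[OF z] by simp
    have \<sigma>: "\<sigma> j \<in> hom E' y (fob F (fob D j))" if "j \<in> Obj J" for j
      using c that by (simp add: cone_def nat_transf_def const_fctr_def FD)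
    have \<sigma>nat: "\<sigma> (Cod J f) = far F (far D f) \<cdot>\<^bsub>E'\<^esub> \<sigma> (Dom J f)" if "f \<in> Arr J" for f
      using c that cod_sur.dom.Comp_Idn_right[OF \<sigma>[OF D.dom.Cod_Obj[OF that]]]
      by (simp add: cone_def nat_transf_def const_fctr_def FD)
    have "\<exists>a. a \<in> hom E z (fob D j) \<and> far F a \<cdot>\<^bsub>E'\<^esub> n = \<sigma> j" if j: "j \<in> Obj J" for j
      using sur_universal_factor[OF un \<sigma>[OF j] D.fob_Obj[OF j]] by blast
    then obtain \<rho> where \<rho>: "\<And>j. j \<in> Obj J \<Longrightarrow> \<rho> j \<in> hom E z (fob D j)"
      and \<rho>n: "\<And>j. j \<in> Obj J \<Longrightarrow> far F (\<rho> j) \<cdot>\<^bsub>E'\<^esub> n = \<sigma> j" by metis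
    have \<rho>u: "far A (\<rho> j) = u" if "j \<in> Obj J" for j
      using arity_transpose[OF n n1 \<rho>[OF that]] \<rho>n[OF that] \<sigma>u that by simp
    have "\<rho> (Cod J f) \<cdot>\<^bsub>E\<^esub> Idn E z = far D f \<cdot>\<^bsub>E\<^esub> \<rho> (Dom J f)" if f: "f \<in> Arr J" for f
    proof -
      note O = D.dom.Dom_Obj[OF f] D.dom.Cod_Obj[OF f]
      have "\<rho> (Cod J f) = far D f \<cdot>\<^bsub>E\<^esub> \<rho> (Dom J f)"
        by (rule sur_universal_eqI[OF un \<rho>[OF O(2)] dom_sur.dom.Comp_hom[OF \<rho>[OF O(1)] Df[OF f]]])
          (simp add: far_Comp_action[OF n \<rho>[OF O(1)] Df[OF f]] \<rho>n O \<sigma>nat[OF f])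
      then show ?thesis using dom_sur.dom.Comp_Idn_right[OF \<rho>[OF O(2)]] by simp
    qed
    then have "cone J E D z \<rho>"
      using \<rho> by (simp add: cone_def nat_transf_def const_fctr_def)
    then have ex1: "\<exists>!f. f \<in> hom E z x \<and> far A f = u \<and> (\<forall>j \<in> Obj J. \<tau> j \<cdot>\<^bsub>E\<^esub> f = \<rho> j)"
      using lim z u \<rho>u zy by (simp add: is_surlimit_def)
    then obtain f where f: "f \<in> hom E z x" and fu: "far A f = u"
      and f\<rho>: "\<And>j. j \<in> Obj J \<Longrightarrow> \<tau> j \<cdot>\<^bsub>E\<^esub> f = \<rho> j" by blast
    show ?thesis
    proof (rule ex1I[of _ "far F f \<cdot>\<^bsub>E'\<^esub> n"], intro conjI ballI)
      show "far F f \<cdot>\<^bsub>E'\<^esub> n \<in> hom E' y (fob F x)"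
        by (rule cod_sur.dom.Comp_hom[OF n far_hom[OF f]])
      show "far A' (far F f \<cdot>\<^bsub>E'\<^esub> n) = u"
        using arity_transpose[OF n n1 f] fu by simp
      show "(far F \<circ> \<tau>) j \<cdot>\<^bsub>E'\<^esub> (far F f \<cdot>\<^bsub>E'\<^esub> n) = \<sigma> j" if j: "j \<in> Obj J" for j
        using far_Comp_action[OF n f \<tau>[OF j]] f\<rho>[OF j] \<rho>n[OF j] by simp
    next
      fix g assume g: "g \<in> hom E' y (fob F x) \<and> far A' g = u \<and>
        (\<forall>j \<in> Obj J. (far F \<circ> \<tau>) j \<cdot>\<^bsub>E'\<^esub> g = \<sigma> j)"
      obtain h where h: "h \<in> hom E z x" and hg: "far F h \<cdot>\<^bsub>E'\<^esub> n = g"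
        using sur_universal_factor[OF un _ x] g by metis
      have "far A h = u" using arity_transpose[OF n n1 h] hg g by simp
      moreover have "\<tau> j \<cdot>\<^bsub>E\<^esub> h = \<rho> j" if j: "j \<in> Obj J" for j
        by (rule sur_universal_eqI[OF un dom_sur.dom.Comp_hom[OF h \<tau>[OF j]] \<rho>[OF j]])
          (use far_Comp_action[OF n h \<tau>[OF j]] hg g \<rho>n[OF j] j in simp)
      ultimately have "h = f" using ex1 f fu f\<rho> h by blast
      then show "g = far F f \<cdot>\<^bsub>E'\<^esub> n" using hg by simp
    qed
  qed
  ultimately show ?thesis
    using fob_Obj[OF x] arity_fob[OF x] xb unfolding is_surlimit_def by blast
qed

text \<open>An arrow that equalizes \<open>far F f\<close> and \<open>far F g\<close> transposes to one that equalizes \<open>f\<close> and \<open>g\<close>,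
  factors there through \<open>e\<close>, and the factor transposes back.\<close>

lemma universal_arrows_preserve_K_equalizers:
  assumes univ: "\<And>y. y \<in> Obj E' \<Longrightarrow> \<exists>z n. sur_universal G E E' A' F y z n"
    and K: "K_pair E A f g" and eq: "is_K_equalizer G E A f g e"
  shows "is_K_equalizer G E' A' (far F f) (far F g) (far F e)"
proof -
  define x y where "x = Dom E f" and "y = Cod E f"
  have f: "f \<in> hom E x y" and g: "g \<in> hom E x y"
    using K by (auto simp: K_pair_def hom_def x_def y_def)
  note e = dom_sur.K_equalizer_hom[OF eq f]
  have E: "is_equalizer E f g e" and fe: "f \<cdot>\<^bsub>E\<^esub> e = g \<cdot>\<^bsub>E\<^esub> e"
    using eq by (auto simp: is_K_equalizer_def is_equalizer_def)
  have Fe: "far F e \<in> hom E' (fob F (Dom E e)) (fob F x)" by (rule far_hom[OF e(1)])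
  have Fe': "Dom E' (far F e) = fob F (Dom E e)" "Cod E' (far F e) = fob F x"
    "far F e \<in> Arr E'" "Dom E' (far F f) = fob F x"
    using Fe far_hom[OF f] by (auto simp: hom_def)
  have "far F f \<cdot>\<^bsub>E'\<^esub> far F e = far F g \<cdot>\<^bsub>E'\<^esub> far F e"
    using far_Comp[OF e(1) f] far_Comp[OF e(1) g] fe by simp
  moreover have "\<exists>!k. k \<in> hom E' w (fob F (Dom E e)) \<and> far F e \<cdot>\<^bsub>E'\<^esub> k = h"
    if w: "w \<in> Obj E'" and h: "h \<in> hom E' w (fob F x)"
      and eqh: "far F f \<cdot>\<^bsub>E'\<^esub> h = far F g \<cdot>\<^bsub>E'\<^esub> h" for w h
  proof -
    obtain z n where un: "sur_universal G E E' A' F w z n" using univ[OF w] by blast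
    then have n: "n \<in> hom E' w (fob F z)" by (simp add: sur_universal_def)
    obtain a where a: "a \<in> hom E z x" and ah: "far F a \<cdot>\<^bsub>E'\<^esub> n = h"
      using sur_universal_factor[OF un h dom_sur.dom.hom_Obj(1)[OF f]] by blast
    have "f \<cdot>\<^bsub>E\<^esub> a = g \<cdot>\<^bsub>E\<^esub> a"
      by (rule sur_universal_eqI[OF un dom_sur.dom.Comp_hom[OF a f] dom_sur.dom.Comp_hom[OF a g]])
        (simp add: far_Comp_action[OF n a f] far_Comp_action[OF n a g] ah eqh)
    then obtain k where k: "k \<in> hom E z (Dom E e)" and ka: "e \<cdot>\<^bsub>E\<^esub> k = a"
      using dom_sur.dom.equalizer_factor[OF E f a] by blast
    show ?thesis
    proof (rule ex1I[of _ "far F k \<cdot>\<^bsub>E'\<^esub> n"], intro conjI)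
      show "far F k \<cdot>\<^bsub>E'\<^esub> n \<in> hom E' w (fob F (Dom E e))"
        by (rule cod_sur.dom.Comp_hom[OF n far_hom[OF k]])
      show "far F e \<cdot>\<^bsub>E'\<^esub> (far F k \<cdot>\<^bsub>E'\<^esub> n) = h"
        using far_Comp_action[OF n k e(1)] ka ah by simp
    next
      fix m assume m: "m \<in> hom E' w (fob F (Dom E e)) \<and> far F e \<cdot>\<^bsub>E'\<^esub> m = h"
      obtain l where l: "l \<in> hom E z (Dom E e)" and lm: "far F l \<cdot>\<^bsub>E'\<^esub> n = m"
        using sur_universal_factor[OF un _ dom_sur.dom.hom_Obj(1)[OF e(1)]] m by metis
      have "e \<cdot>\<^bsub>E\<^esub> l = a"
        by (rule sur_universal_eqI[OF un dom_sur.dom.Comp_hom[OF l e(1)] a])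
          (use far_Comp_action[OF n l e(1)] lm m ah in simp)
      then have "l = k" using dom_sur.dom.equalizer_monic[OF E f g l k] ka by simp
      then show "m = far F k \<cdot>\<^bsub>E'\<^esub> n" using lm by simp
    qed
  qed
  moreover have "far A' (far F e) = Idn G (fob A' (fob F x))"
    using arity_far[OF e(1)] e(2) arity_fob[OF dom_sur.dom.hom_Obj(1)[OF f]] by simp
  ultimately show ?thesis
    by (simp add: is_K_equalizer_def is_equalizer_def Fe')
qed

text \<open>A universal arrow alone is a solution set. A singleton is small because \<open>U\<close> is infinite.\<close>

lemma sur_universal_solution_set:
  fixes U :: "'u set"
  assumes "infinite U" and "sur_universal G E E' A' F y z n"
  shows "solution_set_condition U G E E' A' F y"
proof -
  have "small U {undefined :: 'u}"
    unfolding small_def using assms(1) finite_lesspoll_infinite by blast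
  then show ?thesis
    unfolding solution_set_condition_def
    using assms(2) unfolding sur_universal_def
    by (intro exI[of _ "{undefined}"] exI[of _ "\<lambda>_. z"] exI[of _ "\<lambda>_. n"]) blast
qed

end

section \<open>Surproducts\<close>

text \<open>Surlimits over discrete categories, indexed by sets of any type. Surcompleteness speaks only of
  index categories carried by \<open>'u\<close>, whereas below one of the products is indexed by a set of
  arrows; \<open>small_surproduct\<close> bridges the gap.\<close>

definition is_surproduct ::
  "('g, 'h) cat \<Rightarrow> ('o, 'a) cat \<Rightarrow> ('o, 'a, 'g, 'h) fctr \<Rightarrow> 'i set \<Rightarrow> ('i \<Rightarrow> 'o) \<Rightarrow> 'g \<Rightarrow>
   'o \<Rightarrow> ('i \<Rightarrow> 'a) \<Rightarrow> bool" where
  "is_surproduct G E A I X b x p \<longleftrightarrow>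
     x \<in> Obj E \<and> fob A x = b \<and> (\<forall>i \<in> I. p i \<in> hom E x (X i) \<and> far A (p i) = Idn G b) \<and>
     (\<forall>y \<in> Obj E. \<forall>u \<in> hom G (fob A y) b. \<forall>s.
        (\<forall>i \<in> I. s i \<in> hom E y (X i) \<and> far A (s i) = u) \<longrightarrow>
        (\<exists>!f. f \<in> hom E y x \<and> far A f = u \<and> (\<forall>i \<in> I. p i \<cdot>\<^bsub>E\<^esub> f = s i)))"

definition discrete_cat :: "'i set \<Rightarrow> ('i, 'i) cat" where
  "discrete_cat I =
     \<lparr>Obj = I, Arr = I, Dom = (\<lambda>i. i), Cod = (\<lambda>i. i), Idn = (\<lambda>i. i), Comp = (\<lambda>i _. i)\<rparr>"

lemma category_discrete_cat: "category (discrete_cat I)"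
  by (unfold_locales) (auto simp: discrete_cat_def hom_def)

context surcategory
begin

lemma surproduct_mediator:
  assumes "is_surproduct G E A I X b x p" and "y \<in> Obj E" and "u \<in> hom G (fob A y) b"
    and "\<forall>i \<in> I. s i \<in> hom E y (X i) \<and> far A (s i) = u"
  shows "\<exists>f. f \<in> hom E y x \<and> far A f = u \<and> (\<forall>i \<in> I. p i \<cdot>\<^bsub>E\<^esub> f = s i)"
proof -
  have "\<exists>!f. f \<in> hom E y x \<and> far A f = u \<and> (\<forall>i \<in> I. p i \<cdot>\<^bsub>E\<^esub> f = s i)"
    using assms unfolding is_surproduct_def by simp
  then show ?thesis by (rule ex1_implies_ex)
qed

lemma surproduct_eqI:
  assumes prod: "is_surproduct G E A I X b x p" and b: "b \<in> Obj G"
    and f: "f \<in> hom E y x" and g: "g \<in> hom E y x"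
    and fg: "far A f = far A g" "\<And>i. i \<in> I \<Longrightarrow> p i \<cdot>\<^bsub>E\<^esub> f = p i \<cdot>\<^bsub>E\<^esub> g"
  shows "f = g"
proof -
  have p: "p i \<in> hom E x (X i)" "far A (p i) = Idn G b" if "i \<in> I" for i
    using prod that by (auto simp: is_surproduct_def)
  have y: "y \<in> Obj E" and xb: "fob A x = b"
    using dom.hom_Obj[OF f] prod by (auto simp: is_surproduct_def)
  have u: "far A f \<in> hom G (fob A y) b" using far_hom[OF f] xb by simp
  have "p i \<cdot>\<^bsub>E\<^esub> f \<in> hom E y (X i) \<and> far A (p i \<cdot>\<^bsub>E\<^esub> f) = far A f" if "i \<in> I" for i
    using dom.Comp_hom[OF f p(1)[OF that]] far_Comp_identity_left[OF f p[OF that] b] by simp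
  then have "\<exists>!h. h \<in> hom E y x \<and> far A h = far A f \<and> (\<forall>i \<in> I. p i \<cdot>\<^bsub>E\<^esub> h = p i \<cdot>\<^bsub>E\<^esub> f)"
    using prod y u unfolding is_surproduct_def by auto
  then show ?thesis using f g fg by metis
qed

text \<open>On a discrete category naturality is automatic, so a cone is just a family of arrows. The
  injection \<open>h\<close> copies the index set to another type, and families are transported along its
  inverse.\<close>

lemma surlimit_discrete_surproduct:
  assumes h: "inj_on h I"
    and lim: "is_surlimit G E A (discrete_cat (h ` I)) D b x \<tau>"
    and D: "\<And>i. i \<in> I \<Longrightarrow> fob D (h i) = X i" "\<And>i. i \<in> I \<Longrightarrow> far D (h i) = Idn E (X i)"
  shows "is_surproduct G E A I X b x (\<tau> \<circ> h)"
proof -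
  have cone: "cone (discrete_cat (h ` I)) E D y \<sigma> \<longleftrightarrow> (\<forall>i \<in> I. \<sigma> (h i) \<in> hom E y (X i))" for y \<sigma>
    using D dom.Comp_Idn_left dom.Comp_Idn_right
    by (auto simp: cone_def nat_transf_def const_fctr_def discrete_cat_def)
  have Obj: "Obj (discrete_cat (h ` I)) = h ` I" by (simp add: discrete_cat_def)
  have "\<exists>!f. f \<in> hom E y x \<and> far A f = u \<and> (\<forall>i \<in> I. (\<tau> \<circ> h) i \<cdot>\<^bsub>E\<^esub> f = s i)"
    if y: "y \<in> Obj E" and u: "u \<in> hom G (fob A y) b"
      and s: "\<forall>i \<in> I. s i \<in> hom E y (X i) \<and> far A (s i) = u" for y u s
  proof -
    define \<sigma> where "\<sigma> = s \<circ> inv_into I h"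
    have \<sigma>: "\<sigma> (h i) = s i" if "i \<in> I" for i using h that by (simp add: \<sigma>_def)
    have "cone (discrete_cat (h ` I)) E D y \<sigma> \<and> (\<forall>j \<in> h ` I. far A (\<sigma> j) = u)"
      using s \<sigma> cone by auto
    moreover have "\<forall>y \<in> Obj E. \<forall>u \<in> hom G (fob A y) b. \<forall>\<sigma>.
        cone (discrete_cat (h ` I)) E D y \<sigma> \<and> (\<forall>j \<in> h ` I. far A (\<sigma> j) = u) \<longrightarrow>
        (\<exists>!f. f \<in> hom E y x \<and> far A f = u \<and> (\<forall>j \<in> h ` I. \<tau> j \<cdot>\<^bsub>E\<^esub> f = \<sigma> j))"
      using lim unfolding is_surlimit_def Obj by (elim conjE)
    ultimately have "\<exists>!f. f \<in> hom E y x \<and> far A f = u \<and> (\<forall>j \<in> h ` I. \<tau> j \<cdot>\<^bsub>E\<^esub> f = \<sigma> j)"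
      using y u by simp
    then show ?thesis using \<sigma> by simp
  qed
  moreover have "(\<tau> \<circ> h) i \<in> hom E x (X i) \<and> far A ((\<tau> \<circ> h) i) = Idn G b" if "i \<in> I" for i
    using lim that cone by (auto simp: is_surlimit_def Obj)
  ultimately show ?thesis
    using lim unfolding is_surproduct_def is_surlimit_def by blast
qed

end

context surfunctor
begin

text \<open>The product in \<open>E\<close> and its image under \<open>F\<close> are obtained together, because both come from
  one and the same limit cone.\<close>

lemma small_surproduct:
  fixes U :: "'u set" and X :: "'i \<Rightarrow> 'o"
  assumes comp: "surcomplete U G E A" and pres: "preserves_surlimits U G E A E' A' F"
    and I: "small U I" and b: "b \<in> Obj G"
    and X: "\<And>i. i \<in> I \<Longrightarrow> X i \<in> Obj E" "\<And>i. i \<in> I \<Longrightarrow> fob A (X i) = b"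
  obtains x p where "is_surproduct G E A I X b x p"
    "is_surproduct G E' A' I (fob F \<circ> X) b (fob F x) (far F \<circ> p)"
proof -
  obtain h :: "'i \<Rightarrow> 'u" where h: "inj_on h I"
    using I unfolding small_def lesspoll_def lepoll_def by blast
  define J where "J = discrete_cat (h ` I)"
  define Y where "Y = X \<circ> inv_into I h"
  have Y: "Y (h i) = X i" if "i \<in> I" for i using h that by (simp add: Y_def)
  define D where "D = \<lparr>fob = Y, far = (\<lambda>j. Idn E (Y j))\<rparr>"
  have "small U (h ` I)"
    using I inj_on_image_eqpoll_self[OF h] eqpoll_sym eq_lesspoll_trans
    unfolding small_def by blast
  then have J: "small_category U J"
    using category_discrete_cat by (auto simp: small_category_def J_def discrete_cat_def)
  have "cat_functor J E D"
  proof -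
    interpret J: category J unfolding J_def by (rule category_discrete_cat)
    have "Idn E (X i) \<cdot>\<^bsub>E\<^esub> Idn E (X i) = Idn E (X i)" if "i \<in> I" for i
      by (rule dom_sur.dom.Comp_Idn_left[OF dom_sur.dom.Idn_hom[OF X(1)[OF that]]])
    then show ?thesis
      by unfold_locales
        (use Y X(1) dom_sur.dom.Idn_hom in
          \<open>auto simp: J_def discrete_cat_def D_def hom_def\<close>)
  qed
  then have D: "surdiagram G E A J D b"
    using b X Y dom_sur.far_Idn
    by (auto simp: surdiagram_def fctr_eq_def comp_fctr_def const_fctr_def J_def discrete_cat_def
        D_def)
  obtain x \<tau> where lim: "is_surlimit G E A J D b x \<tau>"
    using comp J D unfolding surcomplete_def by blast
  then have Flim: "is_surlimit G E' A' J (F \<circ>\<^sub>F D) b (fob F x) (far F \<circ> \<tau>)"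
    using pres J D unfolding preserves_surlimits_def by blast
  show ?thesis
  proof (rule that)
    show "is_surproduct G E A I X b x (\<tau> \<circ> h)"
      by (rule dom_sur.surlimit_discrete_surproduct[OF h lim[unfolded J_def]])
        (simp_all add: D_def Y)
    have "is_surproduct G E' A' I (fob F \<circ> X) b (fob F x) ((far F \<circ> \<tau>) \<circ> h)"
      by (rule cod_sur.surlimit_discrete_surproduct[OF h Flim[unfolded J_def]])
        (simp_all add: D_def Y comp_fctr_def far_Idn X)
    then show "is_surproduct G E' A' I (fob F \<circ> X) b (fob F x) (far F \<circ> (\<tau> \<circ> h))"
      by (simp add: comp_assoc)
  qed
qed

end

section \<open>From solution sets to universal arrows\<close>

context surfunctor
begin

text \<open>The surproduct of the \<open>X i\<close> is formed over the arity of \<open>y\<close>, which is the arity of each of them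
  because the arrows \<open>b i\<close> have identity arity. As \<open>F\<close> preserves it, the \<open>b i\<close> assemble to a
  single arrow \<open>b\<close>, and composing with a projection shows that every arrow that factors through some
  \<open>b i\<close> factors through \<open>b\<close>.\<close>

lemma solution_set_weakly_universal:
  fixes U :: "'u set"
  assumes comp: "surcomplete U G E A" and pres: "preserves_surlimits U G E A E' A' F"
    and sol: "solution_set_condition U G E E' A' F y" and y: "y \<in> Obj E'"
  obtains p b where "p \<in> Obj E" "b \<in> hom E' y (fob F p)" "far A' b = Idn G (fob A' y)"
    "\<forall>x \<in> Obj E. \<forall>c \<in> hom E' y (fob F x). \<exists>a \<in> hom E p x. far F a \<cdot>\<^bsub>E'\<^esub> b = c"
proof -
  obtain I :: "'u set" and X \<beta> where I: "small U I"
    and X: "\<And>i. i \<in> I \<Longrightarrow> X i \<in> Obj E" and \<beta>: "\<And>i. i \<in> I \<Longrightarrow> \<beta> i \<in> hom E' y (fob F (X i))"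
    and \<beta>1: "\<And>i. i \<in> I \<Longrightarrow> far A' (\<beta> i) = Idn G (fob A' y)"
    and weak: "\<And>x c. x \<in> Obj E \<Longrightarrow> c \<in> hom E' y (fob F x) \<Longrightarrow>
      \<exists>i \<in> I. \<exists>a \<in> hom E (X i) x. far F a \<cdot>\<^bsub>E'\<^esub> \<beta> i = c"
    using sol unfolding solution_set_condition_def by blast
  note yG = cod_sur.fob_Obj[OF y]
  have XA: "fob A (X i) = fob A' y" if "i \<in> I" for i
    using cod_sur.identity_arity_fob(2)[OF \<beta>[OF that] \<beta>1[OF that] yG] arity_fob[OF X[OF that]]
    by simp
  obtain p \<pi> where prod: "is_surproduct G E A I X (fob A' y) p \<pi>"
    and Fprod: "is_surproduct G E' A' I (fob F \<circ> X) (fob A' y) (fob F p) (far F \<circ> \<pi>)"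
    by (rule small_surproduct[where X = X, OF comp pres I yG X XA])
  have p: "p \<in> Obj E" and \<pi>: "\<And>i. i \<in> I \<Longrightarrow> \<pi> i \<in> hom E p (X i)"
    using prod by (auto simp: is_surproduct_def)
  obtain b where b: "b \<in> hom E' y (fob F p)" "far A' b = Idn G (fob A' y)"
    and \<pi>b: "\<And>i. i \<in> I \<Longrightarrow> far F (\<pi> i) \<cdot>\<^bsub>E'\<^esub> b = \<beta> i"
    using cod_sur.surproduct_mediator[OF Fprod y dom_sur.cod.Idn_hom[OF yG], of \<beta>] \<beta> \<beta>1
    by auto
  have "\<exists>a \<in> hom E p x. far F a \<cdot>\<^bsub>E'\<^esub> b = c" if x: "x \<in> Obj E" and c': "c \<in> hom E' y (fob F x)" for x c
  proof -
    obtain i a where i: "i \<in> I" and a: "a \<in> hom E (X i) x" and c: "far F a \<cdot>\<^bsub>E'\<^esub> \<beta> i = c"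
      using weak[OF x c'] by blast
    have "far F (a \<cdot>\<^bsub>E\<^esub> \<pi> i) \<cdot>\<^bsub>E'\<^esub> b = c"
      using far_Comp_action[OF b(1) \<pi>[OF i] a] \<pi>b[OF i] c by simp
    then show ?thesis using dom_sur.dom.Comp_hom[OF \<pi>[OF i] a] by blast
  qed
  then show ?thesis using that[OF p b] by blast
qed

text \<open>A joint equalizer \<open>m\<close> of all endomorphisms of \<open>p\<close> that fix \<open>b\<close>. Let \<open>S\<close> be the set of
  these, small because the category is locally small. All of them have identity arity, since \<open>b\<close>
  has. Hence they form an arrow \<open>f\<close> from \<open>p\<close> to its surpower over \<open>S\<close>, the diagonal \<open>g\<close> is
  another arrow with the same arity, and a single \<open>K\<close>-equalizer of \<open>f\<close> and \<open>g\<close> equalizes the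
  whole set. Both constructions are preserved by \<open>F\<close>, so \<open>b\<close> factors through \<open>far F m\<close>.\<close>

lemma endomorphism_equalizer:
  fixes U :: "'u set"
  assumes comp: "surcomplete U G E A" and keq: "has_K_equalizers G E A"
    and pres: "preserves_surlimits U G E A E' A' F" and kpres: "preserves_K_equalizers G E A E' A' F"
    and ls: "locally_small U E"
    and b: "b \<in> hom E' y (fob F p)" and b1: "far A' b = Idn G (fob A' y)" and p: "p \<in> Obj E"
  obtains m q n where "m \<in> hom E q p" "far A m = Idn G (fob A p)"
    "n \<in> hom E' y (fob F q)" "far F m \<cdot>\<^bsub>E'\<^esub> n = b"
    "\<forall>s \<in> hom E p p. far F s \<cdot>\<^bsub>E'\<^esub> b = b \<longrightarrow> s \<cdot>\<^bsub>E\<^esub> m = m"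
    "\<forall>z. \<forall>k \<in> hom E z q. \<forall>l \<in> hom E z q. m \<cdot>\<^bsub>E\<^esub> k = m \<cdot>\<^bsub>E\<^esub> l \<longrightarrow> k = l"
proof -
  define S where "S = {s \<in> hom E p p. far F s \<cdot>\<^bsub>E'\<^esub> b = b}"
  have S: "s \<in> hom E p p" "far F s \<cdot>\<^bsub>E'\<^esub> b = b" if "s \<in> S" for s
    using that by (auto simp: S_def)
  have "S \<lesssim> hom E p p" by (rule subset_imp_lepoll) (auto simp: S_def)
  moreover have "hom E p p \<prec> U"
    using ls p by (simp add: locally_small_def small_def)
  ultimately have "small U S"
    unfolding small_def by (rule lesspoll_trans1)
  note y = cod_sur.dom.hom_Obj(1)[OF b]
  note yG = cod_sur.fob_Obj[OF y]
  have py: "fob A p = fob A' y"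
    using cod_sur.identity_arity_fob(2)[OF b b1 yG] arity_fob[OF p] by simp
  define i where "i = Idn G (fob A p)"
  have i: "i \<in> hom G (fob A p) (fob A p)"
    unfolding i_def by (rule dom_sur.cod.Idn_hom[OF dom_sur.fob_Obj[OF p]])
  note pG = dom_sur.fob_Obj[OF p]
  have S1: "far A s = i" if "s \<in> S" for s
    using arity_transpose[OF b b1 S(1)[OF that]] S(2)[OF that] b1 py by (simp add: i_def)
  obtain w \<pi> where prod: "is_surproduct G E A S (\<lambda>_. p) (fob A p) w \<pi>"
    and Fprod: "is_surproduct G E' A' S (fob F \<circ> (\<lambda>_. p)) (fob A p) (fob F w) (far F \<circ> \<pi>)"
    by (rule small_surproduct[where X = "\<lambda>_. p", OF comp pres \<open>small U S\<close> pG p refl])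
  have \<pi>: "\<pi> s \<in> hom E w p" if "s \<in> S" for s
    using prod that by (auto simp: is_surproduct_def)
  obtain f where f: "f \<in> hom E p w" "far A f = i" and \<pi>f: "\<And>s. s \<in> S \<Longrightarrow> \<pi> s \<cdot>\<^bsub>E\<^esub> f = s"
    using dom_sur.surproduct_mediator[OF prod p i, of "\<lambda>s. s"] S S1 by auto
  obtain g where g: "g \<in> hom E p w" "far A g = i"
    and \<pi>g: "\<And>s. s \<in> S \<Longrightarrow> \<pi> s \<cdot>\<^bsub>E\<^esub> g = Idn E p"
    using dom_sur.surproduct_mediator[OF prod p i, of "\<lambda>_. Idn E p"]
      dom_sur.dom.Idn_hom[OF p] dom_sur.far_Idn[OF p] i_def by auto
  have K: "K_pair E A f g" using f g by (auto simp: K_pair_def hom_def)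
  obtain m where eq: "is_K_equalizer G E A f g m"
    using keq K unfolding has_K_equalizers_def by blast
  have Feq: "is_K_equalizer G E' A' (far F f) (far F g) (far F m)"
    using kpres K eq unfolding preserves_K_equalizers_def by blast
  note m = dom_sur.K_equalizer_hom[OF eq f(1)]
  have eq': "is_equalizer E f g m" "is_equalizer E' (far F f) (far F g) (far F m)"
    using eq Feq by (auto simp: is_K_equalizer_def)
  have "far F f \<cdot>\<^bsub>E'\<^esub> b = far F g \<cdot>\<^bsub>E'\<^esub> b"
  proof (rule cod_sur.surproduct_eqI[OF Fprod pG])
    show "far F f \<cdot>\<^bsub>E'\<^esub> b \<in> hom E' y (fob F w)" "far F g \<cdot>\<^bsub>E'\<^esub> b \<in> hom E' y (fob F w)"
      using cod_sur.dom.Comp_hom[OF b] far_hom f(1) g(1) by blast+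
    show "far A' (far F f \<cdot>\<^bsub>E'\<^esub> b) = far A' (far F g \<cdot>\<^bsub>E'\<^esub> b)"
      using arity_transpose[OF b b1 f(1)] arity_transpose[OF b b1 g(1)] f(2) g(2) by simp
    \<comment> \<open>The \<open>s\<close>-components of the two sides are \<open>far F s \<cdot>\<^bsub>E'\<^esub> b\<close> and \<open>b\<close>, equal by the
      choice of \<open>S\<close>.\<close>
    show "(far F \<circ> \<pi>) s \<cdot>\<^bsub>E'\<^esub> (far F f \<cdot>\<^bsub>E'\<^esub> b) = (far F \<circ> \<pi>) s \<cdot>\<^bsub>E'\<^esub> (far F g \<cdot>\<^bsub>E'\<^esub> b)"
      if s: "s \<in> S" for s
      using far_Comp_action[OF b f(1) \<pi>[OF s]] far_Comp_action[OF b g(1) \<pi>[OF s]] \<pi>f[OF s] \<pi>g[OF s]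
        S(2)[OF s] far_Idn[OF p] cod_sur.dom.Comp_Idn_left[OF b] by simp
  qed
  moreover have DomFm: "Dom E' (far F m) = fob F (Dom E m)"
    using far_hom[OF m(1)] by (simp add: hom_def)
  ultimately obtain n where n: "n \<in> hom E' y (fob F (Dom E m))" "far F m \<cdot>\<^bsub>E'\<^esub> n = b"
    using cod_sur.dom.equalizer_factor[OF eq'(2) far_hom[OF f(1)] b, unfolded DomFm] by blast
  have inv: "s \<cdot>\<^bsub>E\<^esub> m = m" if "s \<in> hom E p p" "far F s \<cdot>\<^bsub>E'\<^esub> b = b" for s
  proof -
    have s: "s \<in> S" using that by (simp add: S_def)
    have "f \<cdot>\<^bsub>E\<^esub> m = g \<cdot>\<^bsub>E\<^esub> m" using eq' by (simp add: is_equalizer_def)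
    then have "(\<pi> s \<cdot>\<^bsub>E\<^esub> f) \<cdot>\<^bsub>E\<^esub> m = (\<pi> s \<cdot>\<^bsub>E\<^esub> g) \<cdot>\<^bsub>E\<^esub> m"
      using dom_sur.dom.Comp_assoc[OF m(1) f(1) \<pi>[OF s]]
        dom_sur.dom.Comp_assoc[OF m(1) g(1) \<pi>[OF s]] by simp
    then show ?thesis using \<pi>f[OF s] \<pi>g[OF s] dom_sur.dom.Comp_Idn_left[OF m(1)] by simp
  qed
  show ?thesis
  proof (rule that[OF m(1,2) n], safe)
    show "s \<cdot>\<^bsub>E\<^esub> m = m" if "s \<in> hom E p p" "far F s \<cdot>\<^bsub>E'\<^esub> b = b" for s
      by (rule inv[OF that])
    show "k = l" if "k \<in> hom E z (Dom E m)" "l \<in> hom E z (Dom E m)" "m \<cdot>\<^bsub>E\<^esub> k = m \<cdot>\<^bsub>E\<^esub> l" for z k l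
      by (rule dom_sur.dom.equalizer_monic[OF eq'(1) f(1) g(1) that])
  qed
qed

text \<open>The factor \<open>n\<close> of \<open>b\<close> through the joint equalizer is universal. Existence of factorizations
  is inherited from \<open>b\<close>. For uniqueness, two factorizations \<open>u\<close>, \<open>v\<close> of one arrow have equal
  arities and so a \<open>K\<close>-equalizer \<open>k\<close>; it suffices to find a right inverse of \<open>k\<close>.\<close>

lemma solution_set_sur_universal:
  fixes U :: "'u set"
  assumes comp: "surcomplete U G E A" and keq: "has_K_equalizers G E A"
    and pres: "preserves_surlimits U G E A E' A' F" and kpres: "preserves_K_equalizers G E A E' A' F"
    and ls: "locally_small U E"
    and sol: "solution_set_condition U G E E' A' F y" and y: "y \<in> Obj E'"
  shows "\<exists>x n. sur_universal G E E' A' F y x n"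
proof -
  obtain p b where p: "p \<in> Obj E" and b: "b \<in> hom E' y (fob F p)"
    and b1: "far A' b = Idn G (fob A' y)"
    and weak: "\<forall>x \<in> Obj E. \<forall>c \<in> hom E' y (fob F x).
      \<exists>a \<in> hom E p x. far F a \<cdot>\<^bsub>E'\<^esub> b = c"
    by (rule solution_set_weakly_universal[OF comp pres sol y])
  obtain m q n where m: "m \<in> hom E q p" and m1: "far A m = Idn G (fob A p)"
    and n: "n \<in> hom E' y (fob F q)" and mn: "far F m \<cdot>\<^bsub>E'\<^esub> n = b"
    and inv: "\<forall>s \<in> hom E p p. far F s \<cdot>\<^bsub>E'\<^esub> b = b \<longrightarrow> s \<cdot>\<^bsub>E\<^esub> m = m"
    and monic: "\<forall>z. \<forall>k \<in> hom E z q. \<forall>l \<in> hom E z q. m \<cdot>\<^bsub>E\<^esub> k = m \<cdot>\<^bsub>E\<^esub> l \<longrightarrow> k = l"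
    by (rule endomorphism_equalizer[OF comp keq pres kpres ls b b1 p])
  have q: "q \<in> Obj E" by (rule dom_sur.dom.hom_Obj(1)[OF m])
  have n1: "far A' n = Idn G (fob A' y)"
    using cod_sur.far_Comp_identity_left[OF n far_hom[OF m], of "fob A p"] arity_far[OF m] m1
      dom_sur.fob_Obj[OF p] mn b1 by simp
  have factor: "\<exists>a. a \<in> hom E q x \<and> far F a \<cdot>\<^bsub>E'\<^esub> n = c"
    if x: "x \<in> Obj E" and c: "c \<in> hom E' y (fob F x)" for x c
  proof -
    obtain a where a: "a \<in> hom E p x" and ac: "far F a \<cdot>\<^bsub>E'\<^esub> b = c" using weak x c by blast
    have "far F (a \<cdot>\<^bsub>E\<^esub> m) \<cdot>\<^bsub>E'\<^esub> n = c" using far_Comp_action[OF n m a] mn ac by simp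
    then show ?thesis using dom_sur.dom.Comp_hom[OF m a] by blast
  qed
  have unique: "u = v"
    if u: "u \<in> hom E q x" and v: "v \<in> hom E q x"
      and uv: "far F u \<cdot>\<^bsub>E'\<^esub> n = far F v \<cdot>\<^bsub>E'\<^esub> n" for x u v
  proof -
    have "far A u = far A v"
      using arity_transpose[OF n n1 u] arity_transpose[OF n n1 v] uv by simp
    then have K: "K_pair E A u v" using u v by (auto simp: K_pair_def hom_def)
    obtain k where eq: "is_K_equalizer G E A u v k"
      using keq K unfolding has_K_equalizers_def by blast
    have Feq: "is_K_equalizer G E' A' (far F u) (far F v) (far F k)"
      using kpres K eq unfolding preserves_K_equalizers_def by blast
    define r where "r = Dom E k"
    have k: "k \<in> hom E r q" using dom_sur.K_equalizer_hom(1)[OF eq u] by (simp add: r_def)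
    have eq': "is_equalizer E' (far F u) (far F v) (far F k)" and uk: "u \<cdot>\<^bsub>E\<^esub> k = v \<cdot>\<^bsub>E\<^esub> k"
      using eq Feq by (auto simp: is_K_equalizer_def is_equalizer_def)
    have DomFk: "Dom E' (far F k) = fob F r" using far_hom[OF k] by (simp add: hom_def)
    obtain d where d: "d \<in> hom E' y (fob F r)" and kd: "far F k \<cdot>\<^bsub>E'\<^esub> d = n"
      using cod_sur.dom.equalizer_factor[OF eq' far_hom[OF u] n uv, unfolded DomFk] by blast
    obtain w where w: "w \<in> hom E p r" and wd: "far F w \<cdot>\<^bsub>E'\<^esub> b = d"
      using weak dom_sur.dom.hom_Obj(1)[OF k] d by blast
    note kw = dom_sur.dom.Comp_hom[OF w k]
    note wm = dom_sur.dom.Comp_hom[OF m w]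
    \<comment> \<open>The composite \<open>m k w\<close> is an endomorphism of \<open>p\<close> that fixes \<open>b\<close>, so \<open>m\<close> absorbs it;
      cancelling \<open>m\<close> on the left makes \<open>w m\<close> the right inverse of \<open>k\<close>.\<close>
    have "far F (m \<cdot>\<^bsub>E\<^esub> (k \<cdot>\<^bsub>E\<^esub> w)) \<cdot>\<^bsub>E'\<^esub> b = b"
      using far_Comp_action[OF b kw m] far_Comp_action[OF b w k] wd kd mn by simp
    then have "(m \<cdot>\<^bsub>E\<^esub> (k \<cdot>\<^bsub>E\<^esub> w)) \<cdot>\<^bsub>E\<^esub> m = m"
      using inv dom_sur.dom.Comp_hom[OF kw m] by blast
    then have "m \<cdot>\<^bsub>E\<^esub> (k \<cdot>\<^bsub>E\<^esub> (w \<cdot>\<^bsub>E\<^esub> m)) = m \<cdot>\<^bsub>E\<^esub> Idn E q"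
      by (simp only: dom_sur.dom.Comp_assoc[OF m kw m] dom_sur.dom.Comp_assoc[OF m w k]
          dom_sur.dom.Comp_Idn_right[OF m])
    then have split: "k \<cdot>\<^bsub>E\<^esub> (w \<cdot>\<^bsub>E\<^esub> m) = Idn E q"
      using monic dom_sur.dom.Comp_hom[OF wm k] dom_sur.dom.Idn_hom[OF q] by blast
    have "u = (u \<cdot>\<^bsub>E\<^esub> k) \<cdot>\<^bsub>E\<^esub> (w \<cdot>\<^bsub>E\<^esub> m)"
      by (simp only: dom_sur.dom.Comp_assoc[OF wm k u] split dom_sur.dom.Comp_Idn_right[OF u])
    also have "\<dots> = v"
      by (simp only: uk dom_sur.dom.Comp_assoc[OF wm k v] split dom_sur.dom.Comp_Idn_right[OF v])
    finally show "u = v" .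
  qed
  have "\<exists>!a. a \<in> hom E q x \<and> far F a \<cdot>\<^bsub>E'\<^esub> n = c"
    if "x \<in> Obj E" "c \<in> hom E' y (fob F x)" for x c
    by (rule ex_ex1I[OF factor[OF that]]) (rule unique[where x = x], simp_all)
  then have "sur_universal G E E' A' F y q n"
    using q n n1 unfolding sur_universal_def by blast
  then show ?thesis by blast
qed

end

section \<open>The adjoint functor theorem\<close>

theorem theorem2:
  fixes U :: "'u set"
    and G :: "('g, 'h) cat"
    and \<A> :: "('o, 'a) cat" and A :: "('o, 'a, 'g, 'h) fctr"
    and \<B> :: "('p, 'b) cat" and A' :: "('p, 'b, 'g, 'h) fctr"
    and F :: "('o, 'a, 'p, 'b) fctr"
  assumes "infinite U"
    and "category G"
    and "surcategory G \<A> A"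
    and "surcategory G \<B> A'"
    and "locally_small U \<A>"
    and "surcomplete U G \<A> A"
    and "has_K_equalizers G \<A> A"
    and "surfunctor G \<A> A \<B> A' F"
  shows "has_left_suradjoint G \<A> A \<B> A' F \<longleftrightarrow>
    preserves_surlimits U G \<A> A \<B> A' F \<and>
    preserves_K_equalizers G \<A> A \<B> A' F \<and>
    (\<forall>B \<in> Obj \<B>. solution_set_condition U G \<A> \<B> A' F B)"
proof -
  interpret F: surfunctor G \<A> A \<B> A' F by fact
  show ?thesis
  proof (intro iffI conjI ballI)
    assume "has_left_suradjoint G \<A> A \<B> A' F"
    then have univ: "\<exists>z n. sur_universal G \<A> \<B> A' F y z n" if "y \<in> Obj \<B>" for y
      using F.suradjunction_universal[OF _ that] unfolding has_left_suradjoint_def by metis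
    show "preserves_surlimits U G \<A> A \<B> A' F"
      unfolding preserves_surlimits_def
      by (intro allI impI, elim conjE) (rule F.universal_arrows_preserve_surlimits[OF univ])
    show "preserves_K_equalizers G \<A> A \<B> A' F"
      unfolding preserves_K_equalizers_def
      by (intro allI impI, elim conjE) (rule F.universal_arrows_preserve_K_equalizers[OF univ])
    show "solution_set_condition U G \<A> \<B> A' F B" if "B \<in> Obj \<B>" for B
      using F.sur_universal_solution_set[OF \<open>infinite U\<close>] univ[OF that] by blast
  next
    assume *: "preserves_surlimits U G \<A> A \<B> A' F \<and> preserves_K_equalizers G \<A> A \<B> A' F \<and>
      (\<forall>B \<in> Obj \<B>. solution_set_condition U G \<A> \<B> A' F B)"
    show "has_left_suradjoint G \<A> A \<B> A' F"
    proof (rule F.universal_arrows_suradjoint)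
      fix y assume y: "y \<in> Obj \<B>"
      show "\<exists>x n. sur_universal G \<A> \<B> A' F y x n"
        by (rule F.solution_set_sur_universal[OF assms(6,7) _ _ assms(5) _ y]) (use * y in auto)
    qed
  qed
qed

end
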